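(* Let $\mathsf{C}$ be a category. Then there exists a Scott continuous morphism $(\cdot)^{\natural}$ from $(\mathrm{RCgr}(\mathsf{C}),\subseteq)$ to $(\mathrm{GCgr}(\mathsf{C}),\subseteq)$ such that, for every Riguet congruence $\Phi$ on $\mathsf{C}$, writing $\Phi^{\natural}=(\Phi^{\natural\mathrm{ob}},\Phi^{\natural\mathrm{fl}})$ for its value at $\Phi$: (1) $\Phi^{\natural\mathrm{ob}}=\Phi^{\mathrm{ob}}$; (2) $\Phi^{\natural\mathrm{fl}}$ is the smallest equivalence relation on $\mathrm{Mor}(\mathsf{C})^{+}_{\Phi^{\mathrm{ob}}}$ that contains $\bigcup\Phi^{\mathrm{fl}}$ (i.e. contains all pairs $((f),(f'))$ with $(f,f')$ in some component of $\Phi^{\mathrm{fl}}$) and satisfies conditions (a)--(d) in the definition of generalized congruence relative to $\Phi^{\mathrm{ob}}$; (3) $\Phi^{\natural}$ is a strong generalized congruence on $\mathsf{C}$.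
   Context: A Riguet congruence on a category $\mathsf{C}$ is a pair $\Phi=(\Phi^{\mathrm{ob}},\Phi^{\mathrm{fl}})$ where $\Phi^{\mathrm{ob}}$ is an equivalence relation on $\mathrm{Ob}(\mathsf{C})$ and $\Phi^{\mathrm{fl}}$ assigns to all $(a,a'),(b,b')\in\Phi^{\mathrm{ob}}$ a subset $\Phi^{\mathrm{fl}}_{\left(\begin{smallmatrix}a&b\\ a'&b'\end{smallmatrix}\right)}\subseteq\mathrm{Hom}_{\mathsf{C}}(a,b)\times\mathrm{Hom}_{\mathsf{C}}(a',b')$ such that: (Ra) if $(a,b)\in\Phi^{\mathrm{ob}}$, then $(\mathrm{id}_a,\mathrm{id}_b)\in\Phi^{\mathrm{fl}}_{\left(\begin{smallmatrix}a&a\\ b&b\end{smallmatrix}\right)}$; (Rb) if $f\in\mathrm{Hom}_{\mathsf{C}}(a,b)$, then $(f,f)\in\Phi^{\mathrm{fl}}_{\left(\begin{smallmatrix}a&b\\ a&b\end{smallmatrix}\right)}$; (Rc) if $(f,f')\in\Phi^{\mathrm{fl}}_{\left(\begin{smallmatrix}a&b\\ a'&b'\end{smallmatrix}\right)}$, then $(f',f)\in\Phi^{\mathrm{fl}}_{\left(\begin{smallmatrix}a'&b'\\ a&b\end{smallmatrix}\right)}$; (Rd) if $(f,f')\in\Phi^{\mathrm{fl}}_{\left(\begin{smallmatrix}a&b\\ a'&b'\end{smallmatrix}\right)}$ and $(f',f'')\in\Phi^{\mathrm{fl}}_{\left(\begin{smallmatrix}a'&b'\\ a''&b''\end{smallmatrix}\right)}$,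 then $(f,f'')\in\Phi^{\mathrm{fl}}_{\left(\begin{smallmatrix}a&b\\ a''&b''\end{smallmatrix}\right)}$; (Re) if $(f,f')\in\Phi^{\mathrm{fl}}_{\left(\begin{smallmatrix}a&b\\ a'&b'\end{smallmatrix}\right)}$ and $(g,g')\in\Phi^{\mathrm{fl}}_{\left(\begin{smallmatrix}b&c\\ b'&c'\end{smallmatrix}\right)}$, then $(g\circ f,g'\circ f')\in\Phi^{\mathrm{fl}}_{\left(\begin{smallmatrix}a&c\\ a'&c'\end{smallmatrix}\right)}$; (Rf) for all $(a,a'),(b,b')\in\Phi^{\mathrm{ob}}$ and $f\in\mathrm{Hom}_{\mathsf{C}}(a,b)$ there is $f'\in\mathrm{Hom}_{\mathsf{C}}(a',b')$ with $(f,f')\in\Phi^{\mathrm{fl}}_{\left(\begin{smallmatrix}a&b\\ a'&b'\end{smallmatrix}\right)}$. $\mathrm{RCgr}(\mathsf{C})$ is the set of all Riguet congruences on $\mathsf{C}$. Let $\mathrm{sc}(f)$, $\mathrm{tg}(f)$ be the source and target of a morphism $f$, let $\mathrm{Mor}(\mathsf{C})^{+}$ be the set of finite nonempty sequences $(f_i)_{i\in m}=(f_0,\dots,f_{m-1})$ of morphisms of $\mathsf{C}$, let $(f)$ be the length-one sequence, and let $\curlywedge$ be concatenation. For an equivalence relation $E$ on $\mathrm{Ob}(\mathsf{C})$, $\mathrm{Mor}(\mathsf{C})^{+}_{E}$ is the set of $E$-composable sequences: those $(f_i)_{i\in m}$ with $(\mathrm{tg}(f_i),\mathrm{sc}(f_{i+1}))\in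 E$ for every $i\in m-1$. A generalized congruence on $\mathsf{C}$ is a pair $\Psi=(\Psi^{\mathrm{ob}},\Psi^{\mathrm{fl}})$ where $\Psi^{\mathrm{ob}}$ is an equivalence relation on $\mathrm{Ob}(\mathsf{C})$ and $\Psi^{\mathrm{fl}}$ is an equivalence relation on $\mathrm{Mor}(\mathsf{C})^{+}_{\Psi^{\mathrm{ob}}}$ such that: (a) if $(a,b)\in\Psi^{\mathrm{ob}}$, then $((\mathrm{id}_a),(\mathrm{id}_b))\in\Psi^{\mathrm{fl}}$; (b) if $((f_i)_{i\in m},(g_j)_{j\in n})\in\Psi^{\mathrm{fl}}$, then $(\mathrm{sc}(f_0),\mathrm{sc}(g_0))\in\Psi^{\mathrm{ob}}$ and $(\mathrm{tg}(f_{m-1}),\mathrm{tg}(g_{n-1}))\in\Psi^{\mathrm{ob}}$; (c) if $\mathrm{sc}(g)=\mathrm{tg}(f)$, then $((f,g),(g\circ f))\in\Psi^{\mathrm{fl}}$; (d) if $((f_i)_{i\in m},(f'_{i'})_{i'\in m'}),((g_j)_{j\in n},(g'_{j'})_{j'\in n'})\in\Psi^{\mathrm{fl}}$ and $(\mathrm{tg}(f_{m-1}),\mathrm{sc}(g_0))\in\Psi^{\mathrm{ob}}$, then $((f_i)_{i\in m}\curlywedge(g_j)_{j\in n},(f'_{i'})_{i'\in m'}\curlywedge(g'_{j'})_{j'\in n'})\in\Psi^{\mathrm{fl}}$. $\Psi$ is strong if, for all $(a,a'),(b,b')\in\Psi^{\mathrm{ob}}$ and $f\in\mathrm{Hom}_{\mathsf{C}}(a,b)$,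 there is $f'\in\mathrm{Hom}_{\mathsf{C}}(a',b')$ with $((f),(f'))\in\Psi^{\mathrm{fl}}$. $\mathrm{GCgr}(\mathsf{C})$ is the set of all generalized congruences on $\mathsf{C}$. Inclusion and union are coordinatewise in both sets (for Riguet congruences, componentwise for each index matrix). Directed unions of Riguet (resp. generalized) congruences are again such. Scott continuity of $(\cdot)^{\natural}$ means $\left(\bigcup_{\Phi\in\mathcal{F}}\Phi\right)^{\natural}=\bigcup_{\Phi\in\mathcal{F}}\Phi^{\natural}$ for every nonempty directed $\mathcal{F}\subseteq\mathrm{RCgr}(\mathsf{C})$. *)

theory Defs
  imports Main
begin

section \<open>Categories\<close>

record ('o, 'm) cat_data =
  Ob :: "'o set"
  Mor :: "'m set"
  sc :: "'m \<Rightarrow> 'o"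
  tg :: "'m \<Rightarrow> 'o"
  idm :: "'o \<Rightarrow> 'm"
  cmp :: "'m \<Rightarrow> 'm \<Rightarrow> 'm"

text \<open>Composition is written in the order of function application:
  \<open>cmp C g f\<close> is \<open>g \<circ> f\<close>, and is only constrained when \<open>sc C g = tg C f\<close>.\<close>

locale category =
  fixes C :: "('o, 'm) cat_data"
  assumes sc_Ob: "f \<in> Mor C \<Longrightarrow> sc C f \<in> Ob C"
    and tg_Ob: "f \<in> Mor C \<Longrightarrow> tg C f \<in> Ob C"
    and idm_Mor: "a \<in> Ob C \<Longrightarrow> idm C a \<in> Mor C"
    and sc_idm: "a \<in> Ob C \<Longrightarrow> sc C (idm C a) = a"
    and tg_idm: "a \<in> Ob C \<Longrightarrow> tg C (idm C a) = a"
    and cmp_Mor: "\<lbrakk>f \<in> Mor C; g \<in> Mor C; sc C g = tg C f\<rbrakk> \<Longrightarrow> cmp C g f \<in> Mor C"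
    and sc_cmp: "\<lbrakk>f \<in> Mor C; g \<in> Mor C; sc C g = tg C f\<rbrakk> \<Longrightarrow> sc C (cmp C g f) = sc C f"
    and tg_cmp: "\<lbrakk>f \<in> Mor C; g \<in> Mor C; sc C g = tg C f\<rbrakk> \<Longrightarrow> tg C (cmp C g f) = tg C g"
    and cmp_idm_right: "f \<in> Mor C \<Longrightarrow> cmp C f (idm C (sc C f)) = f"
    and cmp_idm_left: "f \<in> Mor C \<Longrightarrow> cmp C (idm C (tg C f)) f = f"
    and cmp_assoc: "\<lbrakk>f \<in> Mor C; g \<in> Mor C; h \<in> Mor C; sc C g = tg C f; sc C h = tg C g\<rbrakk>
      \<Longrightarrow> cmp C h (cmp C g f) = cmp C (cmp C h g) f"

definition Hom :: "('o, 'm) cat_data \<Rightarrow> 'o \<Rightarrow> 'o \<Rightarrow> 'm set" where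
  "Hom C a b = {f \<in> Mor C. sc C f = a \<and> tg C f = b}"

section \<open>Riguet congruences\<close>

text \<open>The component at the index matrix with rows \<open>(a, b)\<close> and \<open>(a', b')\<close> is \<open>fl a b a' b'\<close>.
  The family is only indexed by matrices with \<open>(a, a')\<close> and \<open>(b, b')\<close> in the object relation;
  as the function type is total, all other components are required to be empty, so that
  equality, inclusion and union of congruences are those of the indexed families.\<close>

type_synonym ('o, 'm) rcgr = "('o \<times> 'o) set \<times> ('o \<Rightarrow> 'o \<Rightarrow> 'o \<Rightarrow> 'o \<Rightarrow> ('m \<times> 'm) set)"

definition riguet_congruence :: "('o, 'm) cat_data \<Rightarrow> ('o, 'm) rcgr \<Rightarrow> bool" where
  "riguet_congruence C \<Phi> \<longleftrightarrow> (let E = fst \<Phi>; fl = snd \<Phi> in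
     equiv (Ob C) E \<and>
     (\<forall>a a' b b'. (a, a') \<in> E \<and> (b, b') \<in> E \<longrightarrow> fl a b a' b' \<subseteq> Hom C a b \<times> Hom C a' b') \<and>
     (\<forall>a a' b b'. \<not> ((a, a') \<in> E \<and> (b, b') \<in> E) \<longrightarrow> fl a b a' b' = {}) \<and>
     (\<forall>a b. (a, b) \<in> E \<longrightarrow> (idm C a, idm C b) \<in> fl a a b b) \<and>
     (\<forall>a\<in>Ob C. \<forall>b\<in>Ob C. \<forall>f\<in>Hom C a b. (f, f) \<in> fl a b a b) \<and>
     (\<forall>a a' b b' f f'. (a, a') \<in> E \<and> (b, b') \<in> E \<and> (f, f') \<in> fl a b a' b'
        \<longrightarrow> (f', f) \<in> fl a' b' a b) \<and>
     (\<forall>a a' a'' b b' b'' f f' f''.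
        (a, a') \<in> E \<and> (a', a'') \<in> E \<and> (b, b') \<in> E \<and> (b', b'') \<in> E \<and>
        (f, f') \<in> fl a b a' b' \<and> (f', f'') \<in> fl a' b' a'' b''
        \<longrightarrow> (f, f'') \<in> fl a b a'' b'') \<and>
     (\<forall>a a' b b' c c' f f' g g'.
        (a, a') \<in> E \<and> (b, b') \<in> E \<and> (c, c') \<in> E \<and>
        (f, f') \<in> fl a b a' b' \<and> (g, g') \<in> fl b c b' c'
        \<longrightarrow> (cmp C g f, cmp C g' f') \<in> fl a c a' c') \<and>
     (\<forall>a a' b b'. (a, a') \<in> E \<and> (b, b') \<in> E
        \<longrightarrow> (\<forall>f\<in>Hom C a b. \<exists>f'\<in>Hom C a' b'. (f, f') \<in> fl a b a' b')))"

definition RCgr :: "('o, 'm) cat_data \<Rightarrow> ('o, 'm) rcgr set" where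
  "RCgr C = {\<Phi>. riguet_congruence C \<Phi>}"

definition rcgr_le :: "('o, 'm) rcgr \<Rightarrow> ('o, 'm) rcgr \<Rightarrow> bool" where
  "rcgr_le \<Phi> \<Phi>' \<longleftrightarrow> fst \<Phi> \<subseteq> fst \<Phi>' \<and> (\<forall>a b a' b'. snd \<Phi> a b a' b' \<subseteq> snd \<Phi>' a b a' b')"

definition rcgr_Union :: "('o, 'm) rcgr set \<Rightarrow> ('o, 'm) rcgr" where
  "rcgr_Union \<F> = (\<Union>\<Phi>\<in>\<F>. fst \<Phi>, \<lambda>a b a' b'. \<Union>\<Phi>\<in>\<F>. snd \<Phi> a b a' b')"

section \<open>Generalized congruences\<close>

definition composable_seqs :: "('o, 'm) cat_data \<Rightarrow> ('o \<times> 'o) set \<Rightarrow> 'm list set" where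
  "composable_seqs C E = {fs. fs \<noteq> [] \<and> set fs \<subseteq> Mor C \<and>
     (\<forall>i. Suc i < length fs \<longrightarrow> (tg C (fs ! i), sc C (fs ! Suc i)) \<in> E)}"

text \<open>These conditions are kept apart from the equivalence-relation requirements, so that they can
  also be imposed on a relation \<open>R\<close> on sequences relative to a fixed \<open>E\<close>. A sequence
  \<open>fs\<close> has first member \<open>hd fs\<close> and last member \<open>last fs\<close>; they are only used on nonempty lists.\<close>

definition gc_conditions ::
    "('o, 'm) cat_data \<Rightarrow> ('o \<times> 'o) set \<Rightarrow> ('m list \<times> 'm list) set \<Rightarrow> bool" where
  "gc_conditions C E R \<longleftrightarrow>
     (\<forall>a b. (a, b) \<in> E \<longrightarrow> ([idm C a], [idm C b]) \<in> R) \<and>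
     (\<forall>fs gs. (fs, gs) \<in> R \<longrightarrow>
        (sc C (hd fs), sc C (hd gs)) \<in> E \<and> (tg C (last fs), tg C (last gs)) \<in> E) \<and>
     (\<forall>f\<in>Mor C. \<forall>g\<in>Mor C. sc C g = tg C f \<longrightarrow> ([f, g], [cmp C g f]) \<in> R) \<and>
     (\<forall>fs fs' gs gs'. (fs, fs') \<in> R \<and> (gs, gs') \<in> R \<and> (tg C (last fs), sc C (hd gs)) \<in> E
        \<longrightarrow> (fs @ gs, fs' @ gs') \<in> R)"

type_synonym ('o, 'm) gcgr = "('o \<times> 'o) set \<times> ('m list \<times> 'm list) set"

definition generalized_congruence :: "('o, 'm) cat_data \<Rightarrow> ('o, 'm) gcgr \<Rightarrow> bool" where
  "generalized_congruence C \<Psi> \<longleftrightarrow>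
     equiv (Ob C) (fst \<Psi>) \<and> equiv (composable_seqs C (fst \<Psi>)) (snd \<Psi>) \<and>
     gc_conditions C (fst \<Psi>) (snd \<Psi>)"

definition strong_generalized_congruence :: "('o, 'm) cat_data \<Rightarrow> ('o, 'm) gcgr \<Rightarrow> bool" where
  "strong_generalized_congruence C \<Psi> \<longleftrightarrow> generalized_congruence C \<Psi> \<and>
     (\<forall>a a' b b'. (a, a') \<in> fst \<Psi> \<and> (b, b') \<in> fst \<Psi>
        \<longrightarrow> (\<forall>f\<in>Hom C a b. \<exists>f'\<in>Hom C a' b'. ([f], [f']) \<in> snd \<Psi>))"

definition GCgr :: "('o, 'm) cat_data \<Rightarrow> ('o, 'm) gcgr set" where
  "GCgr C = {\<Psi>. generalized_congruence C \<Psi>}"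

definition gcgr_le :: "('o, 'm) gcgr \<Rightarrow> ('o, 'm) gcgr \<Rightarrow> bool" where
  "gcgr_le \<Psi> \<Psi>' \<longleftrightarrow> fst \<Psi> \<subseteq> fst \<Psi>' \<and> snd \<Psi> \<subseteq> snd \<Psi>'"

definition gcgr_Union :: "('o, 'm) gcgr set \<Rightarrow> ('o, 'm) gcgr" where
  "gcgr_Union \<G> = (\<Union>\<Psi>\<in>\<G>. fst \<Psi>, \<Union>\<Psi>\<in>\<G>. snd \<Psi>)"

definition singleton_pairs :: "('o, 'm) rcgr \<Rightarrow> ('m list \<times> 'm list) set" where
  "singleton_pairs \<Phi> = {([f], [f']) | f f' a b a' b'.
     (a, a') \<in> fst \<Phi> \<and> (b, b') \<in> fst \<Phi> \<and> (f, f') \<in> snd \<Phi> a b a' b'}"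

definition is_smallest :: "'a set set \<Rightarrow> 'a set \<Rightarrow> bool" where
  "is_smallest \<S> X \<longleftrightarrow> X \<in> \<S> \<and> (\<forall>Y\<in>\<S>. X \<subseteq> Y)"

section \<open>Scott continuity\<close>

definition directed_by :: "('a \<Rightarrow> 'a \<Rightarrow> bool) \<Rightarrow> 'a set \<Rightarrow> bool" where
  "directed_by le D \<longleftrightarrow> D \<noteq> {} \<and> (\<forall>x\<in>D. \<forall>y\<in>D. \<exists>z\<in>D. le x z \<and> le y z)"

definition scott_continuous_morphism ::
    "('o, 'm) cat_data \<Rightarrow> (('o, 'm) rcgr \<Rightarrow> ('o, 'm) gcgr) \<Rightarrow> bool" where
  "scott_continuous_morphism C F \<longleftrightarrow>
     F ` RCgr C \<subseteq> GCgr C \<and>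
     monotone_on (RCgr C) rcgr_le gcgr_le F \<and>
     (\<forall>\<F>. \<F> \<subseteq> RCgr C \<and> directed_by rcgr_le \<F> \<longrightarrow> F (rcgr_Union \<F>) = gcgr_Union (F ` \<F>))"

text \<open>Scott continuity only makes sense because both sets are closed under directed unions.\<close>

lemma equiv_directed_Union:
  assumes ne: "\<F> \<noteq> {}"
    and eq: "\<And>X. X \<in> \<F> \<Longrightarrow> equiv (A X) (r X)"
    and dir: "\<And>X Y. X \<in> \<F> \<Longrightarrow> Y \<in> \<F> \<Longrightarrow> \<exists>Z\<in>\<F>. r X \<subseteq> r Z \<and> r Y \<subseteq> r Z"
  shows "equiv (\<Union>X\<in>\<F>. A X) (\<Union>X\<in>\<F>. r X)"
proof (rule equivI)
  show "(\<Union>X\<in>\<F>. r X) \<subseteq> (\<Union>X\<in>\<F>. A X) \<times> (\<Union>X\<in>\<F>. A X)"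
    using eq by (fastforce simp: equiv_def)
  show "refl_on (\<Union>X\<in>\<F>. A X) (\<Union>X\<in>\<F>. r X)"
    using eq by (fastforce simp: equiv_def refl_on_def)
  show "sym (\<Union>X\<in>\<F>. r X)"
    using eq by (fastforce simp: equiv_def sym_def)
  show "trans (\<Union>X\<in>\<F>. r X)"
  proof (rule transI)
    fix x y z assume "(x, y) \<in> (\<Union>X\<in>\<F>. r X)" "(y, z) \<in> (\<Union>X\<in>\<F>. r X)"
    then obtain X Y where "X \<in> \<F>" "Y \<in> \<F>" "(x, y) \<in> r X" "(y, z) \<in> r Y" by blast
    moreover from this dir obtain Z where Z: "Z \<in> \<F>" "r X \<subseteq> r Z" "r Y \<subseteq> r Z" by meson
    ultimately have "(x, y) \<in> r Z" "(y, z) \<in> r Z" by auto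
    then have "(x, z) \<in> r Z" using eq[OF Z(1)] by (meson equiv_def transD)
    then show "(x, z) \<in> (\<Union>X\<in>\<F>. r X)" using Z(1) by blast
  qed
qed

lemma rcgr_Union_in_RCgr:
  assumes sub: "\<F> \<subseteq> RCgr C" and dir: "directed_by rcgr_le \<F>"
  shows "rcgr_Union \<F> \<in> RCgr C"
proof -
  let ?E = "\<Union>\<Phi>\<in>\<F>. fst \<Phi>"
  let ?fl = "\<lambda>a b a' b'. \<Union>\<Phi>\<in>\<F>. snd \<Phi> a b a' b'"
  have R: "riguet_congruence C \<Phi>" if "\<Phi> \<in> \<F>" for \<Phi>
    using that sub by (auto simp: RCgr_def)
  have ne: "\<F> \<noteq> {}" using dir by (simp add: directed_by_def)
  have ub: "\<exists>\<Theta>\<in>\<F>. rcgr_le \<Phi> \<Theta> \<and> rcgr_le \<Phi>' \<Theta>" if "\<Phi> \<in> \<F>" "\<Phi>' \<in> \<F>" for \<Phi> \<Phi>'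
    using dir that by (simp add: directed_by_def)
  have eqv: "equiv (Ob C) (fst \<Phi>)" if "\<Phi> \<in> \<F>" for \<Phi>
    using R[OF that] by (simp add: riguet_congruence_def Let_def)
  have flD: "(a, a') \<in> fst \<Phi> \<and> (b, b') \<in> fst \<Phi> \<and> f \<in> Hom C a b \<and> f' \<in> Hom C a' b'"
    if "\<Phi> \<in> \<F>" "(f, f') \<in> snd \<Phi> a b a' b'" for \<Phi> a a' b b' f f'
  proof -
    have E: "(a, a') \<in> fst \<Phi> \<and> (b, b') \<in> fst \<Phi>"
      using R[OF that(1)] that(2) unfolding riguet_congruence_def Let_def by (metis empty_iff)
    moreover have "snd \<Phi> a b a' b' \<subseteq> Hom C a b \<times> Hom C a' b'"
      using R[OF that(1)] E unfolding riguet_congruence_def Let_def by simp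
    ultimately show ?thesis using that(2) by auto
  qed
  have "equiv (\<Union>\<Phi>\<in>\<F>. Ob C) ?E"
  proof (rule equiv_directed_Union[OF ne eqv])
    fix X Y assume "X \<in> \<F>" "Y \<in> \<F>"
    from ub[OF this] show "\<exists>Z\<in>\<F>. fst X \<subseteq> fst Z \<and> fst Y \<subseteq> fst Z"
      by (auto simp: rcgr_le_def)
  qed
  then have E: "equiv (Ob C) ?E" using ne by simp
  note RR = R[unfolded riguet_congruence_def Let_def]
  note RaD = RR[THEN conjunct2, THEN conjunct2, THEN conjunct2, THEN conjunct1, rule_format]
  note RbD = RR[THEN conjunct2, THEN conjunct2, THEN conjunct2, THEN conjunct2, THEN conjunct1, rule_format]
  note RcD = RR[THEN conjunct2, THEN conjunct2, THEN conjunct2, THEN conjunct2, THEN conjunct2, THEN conjunct1, rule_format]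
  note RdD = RR[THEN conjunct2, THEN conjunct2, THEN conjunct2, THEN conjunct2, THEN conjunct2, THEN conjunct2, THEN conjunct1, rule_format]
  note ReD = RR[THEN conjunct2, THEN conjunct2, THEN conjunct2, THEN conjunct2, THEN conjunct2, THEN conjunct2, THEN conjunct2, THEN conjunct1, rule_format]
  note RfD = RR[THEN conjunct2, THEN conjunct2, THEN conjunct2, THEN conjunct2, THEN conjunct2, THEN conjunct2, THEN conjunct2, THEN conjunct2, rule_format]
  have Rc: "(f', f) \<in> ?fl a' b' a b" if hyps: "(f, f') \<in> ?fl a b a' b'" for a a' b b' f f'
  proof -
    obtain \<Phi> where P: "\<Phi> \<in> \<F>" "(f, f') \<in> snd \<Phi> a b a' b'" using hyps by blast
    then have "(f', f) \<in> snd \<Phi> a' b' a b"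
      using RcD[OF P(1)] flD[OF P] P(2) by blast
    then show ?thesis using P(1) by blast
  qed
  have Rd: "(f, f'') \<in> ?fl a b a'' b''"
    if hyps: "(f, f') \<in> ?fl a b a' b'" "(f', f'') \<in> ?fl a' b' a'' b''" for a a' a'' b b' b'' f f' f''
  proof -
    obtain \<Phi> \<Phi>' where P: "\<Phi> \<in> \<F>" "(f, f') \<in> snd \<Phi> a b a' b'"
      "\<Phi>' \<in> \<F>" "(f', f'') \<in> snd \<Phi>' a' b' a'' b''" using hyps by blast
    obtain \<Theta> where T: "\<Theta> \<in> \<F>" "rcgr_le \<Phi> \<Theta>" "rcgr_le \<Phi>' \<Theta>" using ub P by blast
    have "(f, f') \<in> snd \<Theta> a b a' b'" "(f', f'') \<in> snd \<Theta> a' b' a'' b''"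
      using P T unfolding rcgr_le_def by blast+
    moreover note flD[OF T(1) this(1)] flD[OF T(1) this(2)]
    ultimately have "(f, f'') \<in> snd \<Theta> a b a'' b''"
      using RdD[OF T(1), of a a' a'' b b' b'' f f' f''] by blast
    then show ?thesis using T(1) by blast
  qed
  have Re: "(cmp C g f, cmp C g' f') \<in> ?fl a c a' c'"
    if hyps: "(f, f') \<in> ?fl a b a' b'" "(g, g') \<in> ?fl b c b' c'" for a a' b b' c c' f f' g g'
  proof -
    obtain \<Phi> \<Phi>' where P: "\<Phi> \<in> \<F>" "(f, f') \<in> snd \<Phi> a b a' b'"
      "\<Phi>' \<in> \<F>" "(g, g') \<in> snd \<Phi>' b c b' c'" using hyps by blast
    obtain \<Theta> where T: "\<Theta> \<in> \<F>" "rcgr_le \<Phi> \<Theta>" "rcgr_le \<Phi>' \<Theta>" using ub P by blast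
    have "(f, f') \<in> snd \<Theta> a b a' b'" "(g, g') \<in> snd \<Theta> b c b' c'"
      using P T unfolding rcgr_le_def by blast+
    moreover note flD[OF T(1) this(1)] flD[OF T(1) this(2)]
    ultimately have "(cmp C g f, cmp C g' f') \<in> snd \<Theta> a c a' c'"
      using ReD[OF T(1), of a a' b b' c c' f f' g g'] by blast
    then show ?thesis using T(1) by blast
  qed
  have Rf: "\<exists>f'\<in>Hom C a' b'. (f, f') \<in> ?fl a b a' b'"
    if hyps: "(a, a') \<in> ?E" "(b, b') \<in> ?E" "f \<in> Hom C a b" for a a' b b' f
  proof -
    obtain \<Phi> \<Phi>' where P: "\<Phi> \<in> \<F>" "(a, a') \<in> fst \<Phi>" "\<Phi>' \<in> \<F>" "(b, b') \<in> fst \<Phi>'"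
      using hyps by blast
    obtain \<Theta> where T: "\<Theta> \<in> \<F>" "rcgr_le \<Phi> \<Theta>" "rcgr_le \<Phi>' \<Theta>" using ub P by blast
    have "(a, a') \<in> fst \<Theta>" "(b, b') \<in> fst \<Theta>"
      using P T unfolding rcgr_le_def by blast+
    then have "\<exists>f'\<in>Hom C a' b'. (f, f') \<in> snd \<Theta> a b a' b'"
      using RfD[OF T(1), of a a' b b' f] hyps(3) by blast
    then show ?thesis using T(1) by blast
  qed
  have Ra: "(idm C a, idm C b) \<in> ?fl a a b b" if hyps: "(a, b) \<in> ?E" for a b
  proof -
    obtain \<Phi> where P: "\<Phi> \<in> \<F>" "(a, b) \<in> fst \<Phi>" using hyps by blast
    then have "(idm C a, idm C b) \<in> snd \<Phi> a a b b"
      using RaD[OF P(1)] by blast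
    then show ?thesis using P(1) by blast
  qed
  have Rb: "(f, f) \<in> ?fl a b a b" if "a \<in> Ob C" "b \<in> Ob C" "f \<in> Hom C a b" for a b f
  proof -
    obtain \<Phi> where P: "\<Phi> \<in> \<F>" using ne by blast
    then have "(f, f) \<in> snd \<Phi> a b a b"
      using RbD[OF P(1)] that by blast
    then show ?thesis using P(1) by blast
  qed
  have sub_Hom: "?fl a b a' b' \<subseteq> Hom C a b \<times> Hom C a' b'" for a b a' b'
    using flD by auto
  have empty: "?fl a b a' b' = {}" if "\<not> ((a, a') \<in> ?E \<and> (b, b') \<in> ?E)" for a b a' b'
  proof (rule ccontr)
    assume "?fl a b a' b' \<noteq> {}"
    then obtain f f' \<Phi> where "\<Phi> \<in> \<F>" "(f, f') \<in> snd \<Phi> a b a' b'" by auto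
    with flD[OF this] that show False by blast
  qed
  show ?thesis
    unfolding RCgr_def riguet_congruence_def rcgr_Union_def Let_def mem_Collect_eq fst_conv snd_conv
  proof (intro conjI)
    show "equiv (Ob C) ?E" by (rule E)
    show "\<forall>a a' b b'. (a, a') \<in> ?E \<and> (b, b') \<in> ?E \<longrightarrow> ?fl a b a' b' \<subseteq> Hom C a b \<times> Hom C a' b'"
      by (intro allI impI sub_Hom)
    show "\<forall>a a' b b'. \<not> ((a, a') \<in> ?E \<and> (b, b') \<in> ?E) \<longrightarrow> ?fl a b a' b' = {}"
      by (intro allI impI empty)
    show "\<forall>a b. (a, b) \<in> ?E \<longrightarrow> (idm C a, idm C b) \<in> ?fl a a b b"
      by (intro allI impI Ra)
    show "\<forall>a\<in>Ob C. \<forall>b\<in>Ob C. \<forall>f\<in>Hom C a b. (f, f) \<in> ?fl a b a b"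
      by (intro ballI Rb)
    show "\<forall>a a' b b' f f'. (a, a') \<in> ?E \<and> (b, b') \<in> ?E \<and> (f, f') \<in> ?fl a b a' b'
        \<longrightarrow> (f', f) \<in> ?fl a' b' a b"
      by (intro allI impI, elim conjE, rule Rc)
    show "\<forall>a a' a'' b b' b'' f f' f''.
        (a, a') \<in> ?E \<and> (a', a'') \<in> ?E \<and> (b, b') \<in> ?E \<and> (b', b'') \<in> ?E \<and>
        (f, f') \<in> ?fl a b a' b' \<and> (f', f'') \<in> ?fl a' b' a'' b''
        \<longrightarrow> (f, f'') \<in> ?fl a b a'' b''"
      by (intro allI impI, elim conjE, rule Rd)
    show "\<forall>a a' b b' c c' f f' g g'.
        (a, a') \<in> ?E \<and> (b, b') \<in> ?E \<and> (c, c') \<in> ?E \<and>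
        (f, f') \<in> ?fl a b a' b' \<and> (g, g') \<in> ?fl b c b' c'
        \<longrightarrow> (cmp C g f, cmp C g' f') \<in> ?fl a c a' c'"
      by (intro allI impI, elim conjE, rule Re)
    show "\<forall>a a' b b'. (a, a') \<in> ?E \<and> (b, b') \<in> ?E
        \<longrightarrow> (\<forall>f\<in>Hom C a b. \<exists>f'\<in>Hom C a' b'. (f, f') \<in> ?fl a b a' b')"
      by (intro allI impI ballI, elim conjE, rule Rf)
  qed
qed

lemma composable_seqs_Union:
  assumes ne: "\<F> \<noteq> {}"
    and dir: "\<And>X Y. X \<in> \<F> \<Longrightarrow> Y \<in> \<F> \<Longrightarrow> \<exists>Z\<in>\<F>. r X \<subseteq> r Z \<and> r Y \<subseteq> r Z"
  shows "composable_seqs C (\<Union>X\<in>\<F>. r X) = (\<Union>X\<in>\<F>. composable_seqs C (r X))"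
proof
  show "(\<Union>X\<in>\<F>. composable_seqs C (r X)) \<subseteq> composable_seqs C (\<Union>X\<in>\<F>. r X)"
    by (fastforce simp: composable_seqs_def)
  show "composable_seqs C (\<Union>X\<in>\<F>. r X) \<subseteq> (\<Union>X\<in>\<F>. composable_seqs C (r X))"
  proof
    fix fs assume fs: "fs \<in> composable_seqs C (\<Union>X\<in>\<F>. r X)"
    have "\<exists>Z\<in>\<F>. \<forall>i<n. Suc i < length fs \<longrightarrow> (tg C (fs ! i), sc C (fs ! Suc i)) \<in> r Z" for n
    proof (induction n)
      case 0
      then show ?case using ne by auto
    next
      case (Suc n)
      then obtain X where X: "X \<in> \<F>"
        "\<forall>i<n. Suc i < length fs \<longrightarrow> (tg C (fs ! i), sc C (fs ! Suc i)) \<in> r X" by blast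
      show ?case
      proof (cases "Suc n < length fs")
        case True
        then obtain Y where Y: "Y \<in> \<F>" "(tg C (fs ! n), sc C (fs ! Suc n)) \<in> r Y"
          using fs by (auto simp: composable_seqs_def)
        obtain Z where "Z \<in> \<F>" "r X \<subseteq> r Z" "r Y \<subseteq> r Z" using dir[OF X(1) Y(1)] by blast
        with X Y show ?thesis by (metis less_antisym subsetD)
      next
        case False
        with X show ?thesis by (metis less_antisym)
      qed
    qed
    from this[of "length fs"] obtain Z where Z: "Z \<in> \<F>"
      "\<forall>i. Suc i < length fs \<longrightarrow> (tg C (fs ! i), sc C (fs ! Suc i)) \<in> r Z"
      by (meson Suc_lessD)
    have "fs \<in> composable_seqs C (r Z)"
      using fs Z(2) by (simp add: composable_seqs_def)
    with Z(1) show "fs \<in> (\<Union>X\<in>\<F>. composable_seqs C (r X))"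
      by (rule UN_I)
  qed
qed

lemma gcgr_Union_in_GCgr:
  assumes sub: "\<G> \<subseteq> GCgr C" and dir: "directed_by gcgr_le \<G>"
  shows "gcgr_Union \<G> \<in> GCgr C"
proof -
  let ?E = "\<Union>\<Psi>\<in>\<G>. fst \<Psi>"
  let ?R = "\<Union>\<Psi>\<in>\<G>. snd \<Psi>"
  have G: "equiv (Ob C) (fst \<Psi>)" "equiv (composable_seqs C (fst \<Psi>)) (snd \<Psi>)"
    "gc_conditions C (fst \<Psi>) (snd \<Psi>)" if "\<Psi> \<in> \<G>" for \<Psi>
    using that sub by (auto simp: GCgr_def generalized_congruence_def)
  have ne: "\<G> \<noteq> {}" using dir by (simp add: directed_by_def)
  have ub: "\<exists>\<Theta>\<in>\<G>. gcgr_le \<Psi> \<Theta> \<and> gcgr_le \<Psi>' \<Theta>" if "\<Psi> \<in> \<G>" "\<Psi>' \<in> \<G>" for \<Psi> \<Psi>'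
    using dir that by (simp add: directed_by_def)
  have ub1: "\<exists>\<Theta>\<in>\<G>. fst \<Psi> \<subseteq> fst \<Theta> \<and> fst \<Psi>' \<subseteq> fst \<Theta>" if "\<Psi> \<in> \<G>" "\<Psi>' \<in> \<G>" for \<Psi> \<Psi>'
    using ub[OF that] by (auto simp: gcgr_le_def)
  have ub2: "\<exists>\<Theta>\<in>\<G>. snd \<Psi> \<subseteq> snd \<Theta> \<and> snd \<Psi>' \<subseteq> snd \<Theta>" if "\<Psi> \<in> \<G>" "\<Psi>' \<in> \<G>" for \<Psi> \<Psi>'
    using ub[OF that] by (auto simp: gcgr_le_def)
  have "equiv (\<Union>\<Psi>\<in>\<G>. Ob C) ?E"
    by (rule equiv_directed_Union[OF ne G(1) ub1])
  then have E: "equiv (Ob C) ?E" using ne by simp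
  have "equiv (\<Union>\<Psi>\<in>\<G>. composable_seqs C (fst \<Psi>)) ?R"
    by (rule equiv_directed_Union[OF ne G(2) ub2])
  then have R: "equiv (composable_seqs C ?E) ?R"
    by (simp only: composable_seqs_Union[where r = fst, OF ne ub1])
  have d: "(fs @ gs, fs' @ gs') \<in> ?R"
    if hyps: "(fs, fs') \<in> ?R" "(gs, gs') \<in> ?R" "(tg C (last fs), sc C (hd gs)) \<in> ?E" for fs fs' gs gs'
  proof -
    obtain X Y Z where P: "X \<in> \<G>" "(fs, fs') \<in> snd X" "Y \<in> \<G>" "(gs, gs') \<in> snd Y"
      "Z \<in> \<G>" "(tg C (last fs), sc C (hd gs)) \<in> fst Z" using hyps by blast
    obtain T where T: "T \<in> \<G>" "gcgr_le X T" "gcgr_le Y T" using ub[OF P(1,3)] by blast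
    obtain U where U: "U \<in> \<G>" "gcgr_le T U" "gcgr_le Z U" using ub[OF T(1) P(5)] by blast
    have "(fs, fs') \<in> snd U" "(gs, gs') \<in> snd U" "(tg C (last fs), sc C (hd gs)) \<in> fst U"
      using P T U by (auto simp: gcgr_le_def)
    then have "(fs @ gs, fs' @ gs') \<in> snd U"
      using G(3)[OF U(1)] unfolding gc_conditions_def by blast
    then show ?thesis using U(1) by blast
  qed
  note GG = G(3)[unfolded gc_conditions_def]
  note aD = GG[THEN conjunct1, rule_format]
  note bD = GG[THEN conjunct2, THEN conjunct1, rule_format]
  note cD = GG[THEN conjunct2, THEN conjunct2, THEN conjunct1, rule_format]
  have a: "([idm C a], [idm C b]) \<in> ?R" if "(a, b) \<in> ?E" for a b
    using that aD by (elim UN_E) (rule UN_I)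
  have b: "(sc C (hd fs), sc C (hd gs)) \<in> ?E \<and> (tg C (last fs), tg C (last gs)) \<in> ?E"
    if hyps: "(fs, gs) \<in> ?R" for fs gs
  proof -
    obtain X where X: "X \<in> \<G>" "(fs, gs) \<in> snd X" using hyps by blast
    from bD[OF this] X(1) show ?thesis by blast
  qed
  have c: "([f, g], [cmp C g f]) \<in> ?R" if "f \<in> Mor C" "g \<in> Mor C" "sc C g = tg C f" for f g
  proof -
    obtain X where X: "X \<in> \<G>" using ne by blast
    from cD[OF X that] X show ?thesis by (intro UN_I)
  qed
  have "gc_conditions C ?E ?R"
    unfolding gc_conditions_def
  proof (intro conjI)
    show "\<forall>a b. (a, b) \<in> ?E \<longrightarrow> ([idm C a], [idm C b]) \<in> ?R"
      by (intro allI impI a)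
    show "\<forall>fs gs. (fs, gs) \<in> ?R \<longrightarrow>
        (sc C (hd fs), sc C (hd gs)) \<in> ?E \<and> (tg C (last fs), tg C (last gs)) \<in> ?E"
      by (intro allI impI b)
    show "\<forall>f\<in>Mor C. \<forall>g\<in>Mor C. sc C g = tg C f \<longrightarrow> ([f, g], [cmp C g f]) \<in> ?R"
      by (intro ballI impI c)
    show "\<forall>fs fs' gs gs'. (fs, fs') \<in> ?R \<and> (gs, gs') \<in> ?R \<and> (tg C (last fs), sc C (hd gs)) \<in> ?E
        \<longrightarrow> (fs @ gs, fs' @ gs') \<in> ?R"
      by (intro allI impI, elim conjE, rule d)
  qed
  with E R show ?thesis
    by (simp add: GCgr_def generalized_congruence_def gcgr_Union_def)
qed

end

theory Submission
  imports Defs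
begin

text \<open>
  The relation \<open>\<Phi>\<^sup>\<natural>\<close> on sequences can only be the intersection of all admissible relations, those
  equivalence relations on \<open>E\<close>-composable sequences (\<open>E = fst \<Phi>\<close>) that contain the pairs of \<open>\<Phi>\<close>
  and satisfy conditions (a)--(d). All of these requirements survive intersections of nonempty families.
  Nonemptiness matters because condition (b) and the restriction to composable sequences are upper
  bounds on the relation: it must be checked that some admissible relation exists.
  The largest candidate is the relation of being parallel up to \<open>E\<close>, that is, of having \<open>E\<close>-related first sources and \<open>E\<close>-related last targets.

  The key fact (\<open>Int_parallel_gc\<close>) is that intersecting with this parallelism relation restricts a
  relation satisfying the conditions for a coarser \<open>E'\<close> to one satisfying them for \<open>E\<close>. Applied to
  the universal relation, with everything \<open>E'\<close>-related, it shows that an admissible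
  relation exists. Applied to an admissible relation for a larger Riguet congruence, it gives monotonicity: the restriction is admissible for
  the smaller congruence, hence contains its \<open>\<natural>\<close>-relation.

  Strength is inherited from the lifting property (Rf), because \<open>\<Phi>\<^sup>\<natural>\<close> contains the pairs of \<open>\<Phi>\<close>. For
  Scott continuity, one inclusion is monotonicity; conversely, the directed union of the
  \<open>\<Phi>\<^sup>\<natural>\<close> is a generalized congruence that contains the pairs of the union of the \<open>\<Phi>\<close>, so minimality
  places \<open>(\<Union>\<Phi>)\<^sup>\<natural>\<close> below it.
\<close>

section \<open>Restriction to parallel sequences\<close>

definition parallel :: "('o, 'm) cat_data \<Rightarrow> ('o \<times> 'o) set \<Rightarrow> ('m list \<times> 'm list) set" where
  "parallel C E = {(fs, gs). fs \<in> composable_seqs C E \<and> gs \<in> composable_seqs C E \<and>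
     (sc C (hd fs), sc C (hd gs)) \<in> E \<and> (tg C (last fs), tg C (last gs)) \<in> E}"

definition admissible :: "('o, 'm) cat_data \<Rightarrow> ('o, 'm) rcgr \<Rightarrow> ('m list \<times> 'm list) set set" where
  "admissible C \<Phi> = {R. equiv (composable_seqs C (fst \<Phi>)) R \<and> singleton_pairs \<Phi> \<subseteq> R \<and>
     gc_conditions C (fst \<Phi>) R}"

definition natural_gc :: "('o, 'm) cat_data \<Rightarrow> ('o, 'm) rcgr \<Rightarrow> ('o, 'm) gcgr" where
  "natural_gc C \<Phi> = (fst \<Phi>, \<Inter> (admissible C \<Phi>))"

lemma composable_seqs_append:
  assumes "fs \<in> composable_seqs C E" "gs \<in> composable_seqs C E"
    and "(tg C (last fs), sc C (hd gs)) \<in> E"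
  shows "fs @ gs \<in> composable_seqs C E"
proof -
  have "(tg C ((fs @ gs) ! i), sc C ((fs @ gs) ! Suc i)) \<in> E" if i: "Suc i < length (fs @ gs)" for i
  proof -
    consider "Suc i < length fs" | "Suc i = length fs" | k where "i = length fs + k"
      by (metis Suc_lessI le_Suc_ex not_le)
    then show ?thesis
    proof cases
      case 1
      then show ?thesis using assms(1) by (simp add: composable_seqs_def nth_append)
    next
      case 2
      then have "(fs @ gs) ! i = last fs" "(fs @ gs) ! Suc i = hd gs"
        using assms(1,2) by (auto simp: composable_seqs_def nth_append last_conv_nth hd_conv_nth
            simp flip: 2)
      then show ?thesis using assms(3) by simp
    next
      case 3
      then show ?thesis using assms(2) i by (simp add: composable_seqs_def nth_append)
    qed
  qed
  then show ?thesis using assms(1,2) by (auto simp: composable_seqs_def)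
qed

lemma composable_seqs_mono: "E \<subseteq> E' \<Longrightarrow> composable_seqs C E \<subseteq> composable_seqs C E'"
  by (auto simp: composable_seqs_def)

lemma singleton_composable: "f \<in> Mor C \<Longrightarrow> [f] \<in> composable_seqs C E"
  by (simp add: composable_seqs_def)

context category
begin

lemma parallel_equiv:
  assumes E: "equiv (Ob C) E"
  shows "equiv (composable_seqs C E) (parallel C E)"
proof (rule equivI)
  show "parallel C E \<subseteq> composable_seqs C E \<times> composable_seqs C E"
    by (auto simp: parallel_def)
  have "hd fs \<in> Mor C \<and> last fs \<in> Mor C" if "fs \<in> composable_seqs C E" for fs
    using that by (auto simp: composable_seqs_def)
  then show "refl_on (composable_seqs C E) (parallel C E)"
    using E sc_Ob tg_Ob by (auto simp: parallel_def refl_on_def equiv_def)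
  show "sym (parallel C E)"
    using E by (auto simp: parallel_def sym_def equiv_def)
  show "trans (parallel C E)"
    unfolding trans_def
  proof (intro allI impI)
    fix x y z assume "(x, y) \<in> parallel C E" "(y, z) \<in> parallel C E"
    moreover have "\<And>a b c. (a, b) \<in> E \<Longrightarrow> (b, c) \<in> E \<Longrightarrow> (a, c) \<in> E"
      using E unfolding equiv_def by (meson transD)
    ultimately show "(x, z) \<in> parallel C E"
      unfolding parallel_def by blast
  qed
qed

text \<open>
  The pairs required by (a) and (c) relative to \<open>E\<close> are parallel up to \<open>E\<close>, and the concatenations
  in (d) of parallel pairs are parallel again. So cutting \<open>R\<close> down to parallel pairs loses none of the
  required ones, while it enforces (b). Reflexivity of \<open>R\<close> is phrased for \<open>E\<close>-composable sequences so
  that \<open>R\<close> may be an equivalence relation on a larger set, such as the \<open>E'\<close>-composable ones.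
\<close>

lemma Int_parallel_gc:
  assumes E: "equiv (Ob C) E" and sub: "E \<subseteq> E'"
    and refl: "\<And>fs. fs \<in> composable_seqs C E \<Longrightarrow> (fs, fs) \<in> R"
    and sym: "sym R" and trans: "trans R"
    and gc: "gc_conditions C E' R"
  shows "equiv (composable_seqs C E) (R \<inter> parallel C E)"
    and "gc_conditions C E (R \<inter> parallel C E)"
proof -
  note P = parallel_equiv[OF E]
  show "equiv (composable_seqs C E) (R \<inter> parallel C E)"
  proof (rule equivI)
    show "R \<inter> parallel C E \<subseteq> composable_seqs C E \<times> composable_seqs C E"
      by (auto simp: parallel_def)
    show "refl_on (composable_seqs C E) (R \<inter> parallel C E)"
      using P refl by (auto simp: equiv_def refl_on_def)
    show "sym (R \<inter> parallel C E)"
      using P sym by (auto simp: equiv_def intro: sym_Int)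
    show "trans (R \<inter> parallel C E)"
      using P trans by (auto simp: equiv_def intro: trans_Int)
  qed
  have E_Ob: "a \<in> Ob C \<and> b \<in> Ob C" if "(a, b) \<in> E" for a b
    using that E by (auto simp: equiv_def)
  have E_refl: "(a, a) \<in> E" if "a \<in> Ob C" for a
    using that E by (auto simp: equiv_def refl_on_def)
  have a: "([idm C a], [idm C b]) \<in> parallel C E" if "(a, b) \<in> E" for a b
    using that E_Ob[OF that]
    by (simp add: parallel_def singleton_composable idm_Mor sc_idm tg_idm)
  have c: "([f, g], [cmp C g f]) \<in> parallel C E" if "f \<in> Mor C" "g \<in> Mor C" "sc C g = tg C f" for f g
  proof -
    have "[f] @ [g] \<in> composable_seqs C E"
      by (rule composable_seqs_append) (use that in \<open>simp_all add: singleton_composable E_refl tg_Ob\<close>)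
    then show ?thesis using that
      by (simp add: parallel_def singleton_composable cmp_Mor sc_cmp tg_cmp E_refl sc_Ob tg_Ob)
  qed
  have d: "(fs @ gs, fs' @ gs') \<in> parallel C E"
    if h: "(fs, fs') \<in> parallel C E" "(gs, gs') \<in> parallel C E" "(tg C (last fs), sc C (hd gs)) \<in> E"
    for fs fs' gs gs'
  proof -
    \<comment> \<open>The primed sequences fit together as well: \<open>tg fs' ~ tg fs ~ sc gs ~ sc gs'\<close>.\<close>
    have "(tg C (last fs'), tg C (last fs)) \<in> E" "(sc C (hd gs), sc C (hd gs')) \<in> E"
      using h(1,2) E by (auto simp: parallel_def equiv_def dest: symD)
    then have "(tg C (last fs'), sc C (hd gs')) \<in> E"
      using h(3) E by (meson equiv_def transD)
    moreover have "fs \<noteq> []" "fs' \<noteq> []" "gs \<noteq> []" "gs' \<noteq> []"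
      using h(1,2) by (auto simp: parallel_def composable_seqs_def)
    ultimately show ?thesis using h
      by (simp add: parallel_def composable_seqs_append)
  qed
  show "gc_conditions C E (R \<inter> parallel C E)"
    unfolding gc_conditions_def
  proof (intro conjI allI impI ballI)
    fix a b assume "(a, b) \<in> E"
    then show "([idm C a], [idm C b]) \<in> R \<inter> parallel C E"
      using a gc sub unfolding gc_conditions_def by blast
  next
    fix fs gs assume "(fs, gs) \<in> R \<inter> parallel C E"
    then show "(sc C (hd fs), sc C (hd gs)) \<in> E" "(tg C (last fs), tg C (last gs)) \<in> E"
      by (auto simp: parallel_def)
  next
    fix f g assume "f \<in> Mor C" "g \<in> Mor C" "sc C g = tg C f"
    then show "([f, g], [cmp C g f]) \<in> R \<inter> parallel C E"
      using c gc unfolding gc_conditions_def by blast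
  next
    fix fs fs' gs gs'
    assume "(fs, fs') \<in> R \<inter> parallel C E \<and> (gs, gs') \<in> R \<inter> parallel C E \<and>
      (tg C (last fs), sc C (hd gs)) \<in> E"
    then show "(fs @ gs, fs' @ gs') \<in> R \<inter> parallel C E"
      using d gc sub unfolding gc_conditions_def by blast
  qed
qed

section \<open>The smallest admissible relation\<close>

lemma RCgr_equiv: "\<Phi> \<in> RCgr C \<Longrightarrow> equiv (Ob C) (fst \<Phi>)"
  by (simp add: RCgr_def riguet_congruence_def Let_def)

lemma RCgr_component_index:
  assumes "\<Phi> \<in> RCgr C" "(f, f') \<in> snd \<Phi> a b a' b'"
  shows "(a, a') \<in> fst \<Phi> \<and> (b, b') \<in> fst \<Phi>"
  using assms unfolding RCgr_def riguet_congruence_def Let_def mem_Collect_eq by (metis empty_iff)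

lemma RCgr_lift:
  assumes "\<Phi> \<in> RCgr C" "(a, a') \<in> fst \<Phi>" "(b, b') \<in> fst \<Phi>" "f \<in> Hom C a b"
  obtains f' where "f' \<in> Hom C a' b'" "(f, f') \<in> snd \<Phi> a b a' b'"
proof -
  have "\<forall>a a' b b'. (a, a') \<in> fst \<Phi> \<and> (b, b') \<in> fst \<Phi>
      \<longrightarrow> (\<forall>f\<in>Hom C a b. \<exists>f'\<in>Hom C a' b'. (f, f') \<in> snd \<Phi> a b a' b')"
    using assms(1) unfolding RCgr_def riguet_congruence_def Let_def mem_Collect_eq
    by (elim conjE)
  with assms(2-4) that show ?thesis by blast
qed

lemma singleton_pairs_parallel:
  assumes "\<Phi> \<in> RCgr C"
  shows "singleton_pairs \<Phi> \<subseteq> parallel C (fst \<Phi>)"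
proof
  fix p assume "p \<in> singleton_pairs \<Phi>"
  then obtain f f' a b a' b' where p: "p = ([f], [f'])" and
    E: "(a, a') \<in> fst \<Phi>" "(b, b') \<in> fst \<Phi>" and fl: "(f, f') \<in> snd \<Phi> a b a' b'"
    unfolding singleton_pairs_def by blast
  have "snd \<Phi> a b a' b' \<subseteq> Hom C a b \<times> Hom C a' b'"
    using assms E by (simp add: RCgr_def riguet_congruence_def Let_def)
  then show "p \<in> parallel C (fst \<Phi>)"
    using fl E p by (auto simp: parallel_def Hom_def singleton_composable)
qed

lemma admissible_nonempty:
  assumes "\<Phi> \<in> RCgr C"
  shows "admissible C \<Phi> \<noteq> {}"
proof -
  \<comment> \<open>Relative to the total relation on objects, (b) is vacuous.\<close>
  have "gc_conditions C UNIV UNIV" by (simp add: gc_conditions_def)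
  then have "equiv (composable_seqs C (fst \<Phi>)) (UNIV \<inter> parallel C (fst \<Phi>))"
    "gc_conditions C (fst \<Phi>) (UNIV \<inter> parallel C (fst \<Phi>))"
    using Int_parallel_gc[OF RCgr_equiv[OF assms], of UNIV UNIV] by (simp_all add: sym_def trans_def)
  with singleton_pairs_parallel[OF assms] show ?thesis
    by (auto simp: admissible_def)
qed

lemma Inter_admissible:
  assumes "\<Phi> \<in> RCgr C"
  shows "\<Inter> (admissible C \<Phi>) \<in> admissible C \<Phi>"
proof -
  let ?A = "admissible C \<Phi>"
  have ne: "?A \<noteq> {}" using assms by (rule admissible_nonempty)
  have eqv: "equiv (composable_seqs C (fst \<Phi>)) R"
    and gc: "gc_conditions C (fst \<Phi>) R" if "R \<in> ?A" for R
    using that by (simp_all add: admissible_def)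
  have "equiv (composable_seqs C (fst \<Phi>)) (\<Inter> ?A)"
  proof (rule equivI)
    show "\<Inter> ?A \<subseteq> composable_seqs C (fst \<Phi>) \<times> composable_seqs C (fst \<Phi>)"
      using ne eqv by (fastforce simp: equiv_def)
    show "refl_on (composable_seqs C (fst \<Phi>)) (\<Inter> ?A)"
      using eqv by (auto simp: equiv_def refl_on_def)
    show "sym (\<Inter> ?A)"
      using eqv by (auto simp: equiv_def sym_def)
    show "trans (\<Inter> ?A)"
      using eqv unfolding equiv_def trans_def by blast
  qed
  moreover have "singleton_pairs \<Phi> \<subseteq> \<Inter> ?A"
    by (auto simp: admissible_def)
  moreover have "gc_conditions C (fst \<Phi>) (\<Inter> ?A)"
    unfolding gc_conditions_def
  proof (intro conjI allI impI ballI)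
    fix a b assume "(a, b) \<in> fst \<Phi>"
    then show "([idm C a], [idm C b]) \<in> \<Inter> ?A"
      using gc unfolding gc_conditions_def by blast
  next
    fix fs gs assume h: "(fs, gs) \<in> \<Inter> ?A"
    obtain R where "R \<in> ?A" using ne by blast
    with h gc[OF this] show "(sc C (hd fs), sc C (hd gs)) \<in> fst \<Phi>"
      "(tg C (last fs), tg C (last gs)) \<in> fst \<Phi>"
      unfolding gc_conditions_def by blast+
  next
    fix f g assume "f \<in> Mor C" "g \<in> Mor C" "sc C g = tg C f"
    then show "([f, g], [cmp C g f]) \<in> \<Inter> ?A"
      using gc unfolding gc_conditions_def by blast
  next
    fix fs fs' gs gs'
    assume "(fs, fs') \<in> \<Inter> ?A \<and> (gs, gs') \<in> \<Inter> ?A \<and> (tg C (last fs), sc C (hd gs)) \<in> fst \<Phi>"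
    then show "(fs @ gs, fs' @ gs') \<in> \<Inter> ?A"
      using gc unfolding gc_conditions_def by blast
  qed
  ultimately show ?thesis by (simp add: admissible_def)
qed

lemma natural_gc_strong:
  assumes "\<Phi> \<in> RCgr C"
  shows "strong_generalized_congruence C (natural_gc C \<Phi>)"
proof -
  have N: "snd (natural_gc C \<Phi>) \<in> admissible C \<Phi>" and O: "fst (natural_gc C \<Phi>) = fst \<Phi>"
    using Inter_admissible[OF assms] by (simp_all add: natural_gc_def)
  have "\<exists>f'\<in>Hom C a' b'. ([f], [f']) \<in> snd (natural_gc C \<Phi>)"
    if h: "(a, a') \<in> fst \<Phi>" "(b, b') \<in> fst \<Phi>" "f \<in> Hom C a b" for a a' b b' f
  proof -
    obtain f' where f': "f' \<in> Hom C a' b'" "(f, f') \<in> snd \<Phi> a b a' b'"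
      using RCgr_lift[OF assms h] .
    then have "([f], [f']) \<in> singleton_pairs \<Phi>"
      using h unfolding singleton_pairs_def by blast
    with N f'(1) show ?thesis by (auto simp: admissible_def)
  qed
  with N RCgr_equiv[OF assms] O show ?thesis
    by (auto simp: strong_generalized_congruence_def generalized_congruence_def admissible_def)
qed

lemma natural_gc_in_GCgr: "\<Phi> \<in> RCgr C \<Longrightarrow> natural_gc C \<Phi> \<in> GCgr C"
  using natural_gc_strong by (auto simp: GCgr_def strong_generalized_congruence_def)

section \<open>Monotonicity and directed unions\<close>

lemma singleton_pairs_mono: "rcgr_le \<Phi> \<Phi>' \<Longrightarrow> singleton_pairs \<Phi> \<subseteq> singleton_pairs \<Phi>'"
  unfolding rcgr_le_def singleton_pairs_def by blast

lemma admissible_Int_parallel: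
  assumes "\<Phi> \<in> RCgr C" "rcgr_le \<Phi> \<Phi>'" "R \<in> admissible C \<Phi>'"
  shows "R \<inter> parallel C (fst \<Phi>) \<in> admissible C \<Phi>"
proof -
  have sub: "fst \<Phi> \<subseteq> fst \<Phi>'" using assms(2) by (simp add: rcgr_le_def)
  have R: "equiv (composable_seqs C (fst \<Phi>')) R" "singleton_pairs \<Phi>' \<subseteq> R"
    "gc_conditions C (fst \<Phi>') R"
    using assms(3) by (auto simp: admissible_def)
  have refl: "(fs, fs) \<in> R" if "fs \<in> composable_seqs C (fst \<Phi>)" for fs
    using that composable_seqs_mono[OF sub] R(1) by (auto simp: equiv_def refl_on_def)
  have "sym R" "trans R" using R(1) by (simp_all add: equiv_def)
  then have "equiv (composable_seqs C (fst \<Phi>)) (R \<inter> parallel C (fst \<Phi>))"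
    "gc_conditions C (fst \<Phi>) (R \<inter> parallel C (fst \<Phi>))"
    using Int_parallel_gc[OF RCgr_equiv[OF assms(1)] sub refl _ _ R(3)] by auto
  with singleton_pairs_parallel[OF assms(1)] singleton_pairs_mono[OF assms(2)] R(2)
  show ?thesis by (auto simp: admissible_def)
qed

lemma natural_gc_mono:
  assumes "\<Phi> \<in> RCgr C" "rcgr_le \<Phi> \<Phi>'"
  shows "gcgr_le (natural_gc C \<Phi>) (natural_gc C \<Phi>')"
  using admissible_Int_parallel[OF assms] assms(2)
  by (auto simp: gcgr_le_def natural_gc_def rcgr_le_def)

lemma natural_gc_Union:
  assumes sub: "\<F> \<subseteq> RCgr C" and dir: "directed_by rcgr_le \<F>"
  shows "natural_gc C (rcgr_Union \<F>) = gcgr_Union (natural_gc C ` \<F>)"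
proof -
  let ?U = "rcgr_Union \<F>" and ?G = "gcgr_Union (natural_gc C ` \<F>)"
  have fst_eq: "fst ?G = fst ?U"
    by (simp add: gcgr_Union_def rcgr_Union_def natural_gc_def)
  have "directed_by gcgr_le (natural_gc C ` \<F>)"
    unfolding directed_by_def
  proof (intro conjI ballI)
    show "natural_gc C ` \<F> \<noteq> {}" using dir by (simp add: directed_by_def)
  next
    fix x y assume "x \<in> natural_gc C ` \<F>" "y \<in> natural_gc C ` \<F>"
    then obtain \<Phi> \<Phi>' where P: "\<Phi> \<in> \<F>" "\<Phi>' \<in> \<F>" "x = natural_gc C \<Phi>" "y = natural_gc C \<Phi>'"
      by blast
    then obtain \<Theta> where "\<Theta> \<in> \<F>" "rcgr_le \<Phi> \<Theta>" "rcgr_le \<Phi>' \<Theta>"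
      using dir unfolding directed_by_def by blast
    then show "\<exists>z\<in>natural_gc C ` \<F>. gcgr_le x z \<and> gcgr_le y z"
      using P sub natural_gc_mono by blast
  qed
  moreover have "natural_gc C ` \<F> \<subseteq> GCgr C"
    using sub natural_gc_in_GCgr by blast
  ultimately have G: "generalized_congruence C ?G"
    using gcgr_Union_in_GCgr[of "natural_gc C ` \<F>" C] by (simp add: GCgr_def)
  have "singleton_pairs ?U \<subseteq> snd ?G"
  proof
    fix p assume "p \<in> singleton_pairs ?U"
    then obtain f f' a b a' b' \<Phi> where p: "p = ([f], [f'])" "\<Phi> \<in> \<F>" "(f, f') \<in> snd \<Phi> a b a' b'"
      unfolding singleton_pairs_def rcgr_Union_def fst_conv snd_conv by blast
    \<comment> \<open>Components of \<open>\<Phi>\<close> are empty outside its own object relation, so the index lies in \<open>fst \<Phi>\<close>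
      and not merely in the union.\<close>
    have "(a, a') \<in> fst \<Phi> \<and> (b, b') \<in> fst \<Phi>"
      by (rule RCgr_component_index[OF _ p(3)]) (use sub p(2) in blast)
    then have "p \<in> singleton_pairs \<Phi>"
      using p unfolding singleton_pairs_def by blast
    then have "p \<in> snd (natural_gc C \<Phi>)"
      by (auto simp: natural_gc_def admissible_def)
    then show "p \<in> snd ?G" using p(2) by (auto simp: gcgr_Union_def)
  qed
  then have "snd ?G \<in> admissible C ?U"
    using G fst_eq by (simp add: admissible_def generalized_congruence_def)
  then have "snd (natural_gc C ?U) \<subseteq> snd ?G"
    by (auto simp: natural_gc_def)
  moreover have "snd ?G \<subseteq> snd (natural_gc C ?U)"
  proof -
    have "gcgr_le (natural_gc C \<Phi>) (natural_gc C ?U)" if "\<Phi> \<in> \<F>" for \<Phi>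
      using that sub by (intro natural_gc_mono) (auto simp: rcgr_le_def rcgr_Union_def)
    then show ?thesis by (auto simp: gcgr_Union_def gcgr_le_def)
  qed
  ultimately show ?thesis
    using fst_eq by (intro prod_eqI) (auto simp: natural_gc_def)
qed

lemma natural_gc_scott_continuous: "scott_continuous_morphism C (natural_gc C)"
  unfolding scott_continuous_morphism_def monotone_on_def
  by (simp add: image_subset_iff natural_gc_in_GCgr natural_gc_mono natural_gc_Union)

end

theorem theorem2p36:
  fixes C :: "('o, 'm) cat_data"
  assumes "category C"
  shows "\<exists>nat_op :: ('o, 'm) rcgr \<Rightarrow> ('o, 'm) gcgr.
    scott_continuous_morphism C nat_op \<and>
    (\<forall>\<Phi>\<in>RCgr C.
       fst (nat_op \<Phi>) = fst \<Phi> \<and>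
       is_smallest
         {R. equiv (composable_seqs C (fst \<Phi>)) R \<and> singleton_pairs \<Phi> \<subseteq> R \<and>
             gc_conditions C (fst \<Phi>) R}
         (snd (nat_op \<Phi>)) \<and>
       strong_generalized_congruence C (nat_op \<Phi>))"
proof -
  interpret category C by (rule assms)
  have "is_smallest (admissible C \<Phi>) (snd (natural_gc C \<Phi>))" if "\<Phi> \<in> RCgr C" for \<Phi>
    using Inter_admissible[OF that] by (auto simp: is_smallest_def natural_gc_def)
  then show ?thesis
    using natural_gc_scott_continuous natural_gc_strong
    by (intro exI[of _ "natural_gc C"]) (simp add: admissible_def natural_gc_def)
qed

end
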